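(* Let $r\ge 2$ be an integer. (i) Let $\eta_1,\dots,\eta_r$ be pairwise distinct complex numbers of absolute value $1$ and $\gamma_1,\dots,\gamma_r$ non-zero complex numbers. Then there exists a constant $d_1>0$ such that $|\gamma_1\eta_1^n+\dots+\gamma_r\eta_r^n|>d_1$ holds for infinitely many positive integers $n$. (ii) Let $\eta_1,\dots,\eta_r$ be pairwise distinct complex numbers of absolute value $1$ such that at least one of the quotients $\eta_j/\eta_r$, $1\le j<r$, is not a root of unity, and let $\gamma_1,\dots,\gamma_{r-1}$ be non-zero complex numbers. Then for every $d_2>1$ there exists $\gamma_r\in\mathbb{C}$ such that $|\gamma_1\eta_1^n+\dots+\gamma_r\eta_r^n|<d_2^{-n}$ holds for infinitely many positive integers $n$. *)

theory Defs
  imports "HOL-Analysis.Analysis"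
begin

definition root_of_unity :: "complex \<Rightarrow> bool" where
  "root_of_unity z \<longleftrightarrow> (\<exists>k::nat. k > 0 \<and> z ^ k = 1)"

end

theory Submission
  imports Defs
begin

text \<open>
  (i) Multiplying by $\overline{\eta_r}^n$ and averaging over $n$ isolates the coefficient
  $\gamma_r$; if the sum were at most $|\gamma_r|/2$ for almost all $n$, so would be the limit
  $|\gamma_r|$ of the averages.

  (ii) After division by $\eta_r^n$, one has to find a complex number that is approximated
  very well by values of $f(n) = -\sum_{j<r} \gamma_j (\eta_j/\eta_r)^n$. By compactness of the
  torus, $f$ returns arbitrarily closely to each of its values, so one can choose
  $n_1 < n_2 < \dots$ such that $f(n_{k+1})$ is extremely close to $f(n_k)$; the limit of
  $f(n_k)$ is the required coefficient.
\<close>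

section \<open>Averages over the exponent and the lower bound\<close>

lemma norm_geometric_sum_le:
  fixes z :: complex
  assumes "norm z = 1" "z \<noteq> 1"
  shows "norm (\<Sum>n<N. z ^ n) \<le> 2 / norm (z - 1)"
proof -
  have "norm (z ^ N - 1) \<le> norm (z ^ N) + norm (1::complex)"
    by (rule norm_triangle_ineq4)
  also have "\<dots> = 2"
    using assms by (simp add: norm_power)
  finally have "norm (z ^ N - 1) \<le> 2" .
  then show ?thesis
    using assms by (simp add: geometric_sum norm_divide divide_right_mono)
qed

text \<open>The closed form of the geometric sum bounds the partial sums uniformly in
  \<open>N\<close>, so dividing by \<open>N\<close> sends them to 0.\<close>

lemma average_powers_tendsto_0:
  fixes z :: complex
  assumes "norm z = 1" "z \<noteq> 1"
  shows "(\<lambda>N. (\<Sum>n<N. z ^ n) / of_nat N) \<longlonglongrightarrow> 0"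
proof (rule Lim_null_comparison)
  show "\<forall>\<^sub>F N in sequentially.
      norm ((\<Sum>n<N. z ^ n) / of_nat N) \<le> (2 / norm (z - 1)) / real N"
    unfolding norm_divide norm_of_nat
    by (intro always_eventually allI divide_right_mono norm_geometric_sum_le assms) simp
  show "(\<lambda>N. (2 / norm (z - 1)) / real N) \<longlonglongrightarrow> 0"
    by (rule lim_const_over_n)
qed

text \<open>Dividing by \<open>\<eta> i ^ n\<close> makes the term of index \<open>i\<close>
  constant. By injectivity every other term becomes a multiple of the powers of some number of norm
  1 different from 1, and these average to 0.\<close>

lemma average_exponential_sum_tendsto:
  fixes \<eta> \<gamma> :: "'i \<Rightarrow> complex"
  assumes "finite J" "i \<in> J" "inj_on \<eta> J" "\<And>j. j \<in> J \<Longrightarrow> norm (\<eta> j) = 1"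
  shows "(\<lambda>N. (\<Sum>n<N. (\<Sum>j\<in>J. \<gamma> j * \<eta> j ^ n) / \<eta> i ^ n) / of_nat N) \<longlonglongrightarrow> \<gamma> i"
proof -
  have *: "(\<lambda>N. (\<Sum>n<N. (\<eta> j / \<eta> i) ^ n) / of_nat N) \<longlonglongrightarrow> of_bool (j = i)"
    if "j \<in> J" for j
  proof (cases "j = i")
    case True
    have "\<eta> i \<noteq> 0"
      using assms(2,4) by fastforce
    \<comment> \<open>Only eventually: at \<open>N = 0\<close> the quotient is 0 by the convention
      for division by zero.\<close>
    moreover have "\<forall>\<^sub>F N in sequentially. (of_nat N / of_nat N :: complex) = 1"
      using eventually_gt_at_top[of 0] by eventually_elim simp
    ultimately show ?thesis
      using True by (simp add: tendsto_eventually)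
  next
    case False
    then have "\<eta> j / \<eta> i \<noteq> 1"
      using assms(2,3) that by (auto simp: inj_on_def)
    moreover have "norm (\<eta> j / \<eta> i) = 1"
      using assms(2,4) that by (simp add: norm_divide)
    ultimately show ?thesis
      using average_powers_tendsto_0 False by simp
  qed
  have "(\<lambda>N. \<Sum>j\<in>J. \<gamma> j * ((\<Sum>n<N. (\<eta> j / \<eta> i) ^ n) / of_nat N))
      \<longlonglongrightarrow> (\<Sum>j\<in>J. \<gamma> j * of_bool (j = i))"
    by (intro tendsto_sum tendsto_mult tendsto_const *)
  also have "(\<Sum>j\<in>J. \<gamma> j * of_bool (j = i)) = \<gamma> i"
    using assms(1,2) by (simp add: of_bool_def if_distrib sum.delta cong: if_cong)
  also have "(\<lambda>N. \<Sum>j\<in>J. \<gamma> j * ((\<Sum>n<N. (\<eta> j / \<eta> i) ^ n) / of_nat N)) =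
      (\<lambda>N. (\<Sum>n<N. (\<Sum>j\<in>J. \<gamma> j * \<eta> j ^ n) / \<eta> i ^ n) / of_nat N)"
  proof
    fix N
    have "(\<Sum>n<N. (\<Sum>j\<in>J. \<gamma> j * \<eta> j ^ n) / \<eta> i ^ n) =
        (\<Sum>n<N. \<Sum>j\<in>J. \<gamma> j * (\<eta> j / \<eta> i) ^ n)"
      by (simp add: sum_divide_distrib power_divide)
    also have "\<dots> = (\<Sum>j\<in>J. \<gamma> j * (\<Sum>n<N. (\<eta> j / \<eta> i) ^ n))"
      by (subst sum.swap) (simp add: sum_distrib_left)
    finally show "(\<Sum>j\<in>J. \<gamma> j * ((\<Sum>n<N. (\<eta> j / \<eta> i) ^ n) / of_nat N)) =
        (\<Sum>n<N. (\<Sum>j\<in>J. \<gamma> j * \<eta> j ^ n) / \<eta> i ^ n) / of_nat N"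
      by (simp only: times_divide_eq_right flip: sum_divide_distrib)
  qed
  finally show ?thesis .
qed

text \<open>The terms before the bound sets in contribute a fixed amount \<open>B\<close>, which
  division by \<open>N\<close> makes negligible.\<close>

lemma norm_average_limit_le:
  fixes u :: "nat \<Rightarrow> complex"
  assumes "\<forall>\<^sub>F n in sequentially. norm (u n) \<le> d"
    and lim: "(\<lambda>N. (\<Sum>n<N. u n) / of_nat N) \<longlonglongrightarrow> c"
  shows "norm c \<le> d"
proof -
  obtain M where M: "\<And>n. n \<ge> M \<Longrightarrow> norm (u n) \<le> d"
    using assms(1) by (auto simp: eventually_sequentially)
  have d: "0 \<le> d"
    using M[of M] norm_ge_zero order_trans by blast
  define B where "B = (\<Sum>n<M. norm (u n))"
  have "\<forall>\<^sub>F N in sequentially. norm ((\<Sum>n<N. u n) / of_nat N) \<le> B / real N + d"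
    using eventually_gt_at_top[of M]
  proof eventually_elim
    case (elim N)
    have "norm (\<Sum>n<N. u n) \<le> (\<Sum>n<N. norm (u n))"
      by (rule norm_sum)
    also have "\<dots> = B + (\<Sum>n=M..<N. norm (u n))"
      unfolding B_def lessThan_atLeast0
      using elim by (intro sum.atLeastLessThan_concat[symmetric]) auto
    also have "(\<Sum>n=M..<N. norm (u n)) \<le> real (card {M..<N}) * d"
      using M by (intro sum_bounded_above) auto
    also have "real (card {M..<N}) * d \<le> real N * d"
      using d by (intro mult_right_mono) auto
    finally have "norm (\<Sum>n<N. u n) / real N \<le> (B + real N * d) / real N"
      by (intro divide_right_mono) auto
    then show ?case
      using elim by (simp add: norm_divide add_divide_distrib)
  qed
  moreover have "(\<lambda>N. B / real N + d) \<longlonglongrightarrow> 0 + d"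
    by (intro tendsto_add lim_const_over_n tendsto_const)
  ultimately show ?thesis
    using tendsto_le[OF _ _ tendsto_norm[OF lim]] by fastforce
qed

text \<open>Otherwise the sums would eventually have norm at most \<open>d\<close>. Division by
  \<open>\<eta> i ^ n\<close> preserves norms, so the limit \<open>\<gamma> i\<close> of the
  averages would have norm at most \<open>d\<close> too.\<close>

lemma exponential_sum_infinitely_often_large:
  fixes \<eta> \<gamma> :: "'i \<Rightarrow> complex"
  assumes "finite J" "i \<in> J" "inj_on \<eta> J" "\<And>j. j \<in> J \<Longrightarrow> norm (\<eta> j) = 1"
    and "d < norm (\<gamma> i)"
  shows "infinite {n. norm (\<Sum>j\<in>J. \<gamma> j * \<eta> j ^ n) > d}"
proof
  assume "finite {n. norm (\<Sum>j\<in>J. \<gamma> j * \<eta> j ^ n) > d}"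
  then have "\<forall>\<^sub>F n in sequentially. norm (\<Sum>j\<in>J. \<gamma> j * \<eta> j ^ n) \<le> d"
    by (simp add: cofinite_eq_sequentially[symmetric] eventually_cofinite not_le)
  then have "\<forall>\<^sub>F n in sequentially. norm ((\<Sum>j\<in>J. \<gamma> j * \<eta> j ^ n) / \<eta> i ^ n) \<le> d"
    using assms(2,4) by (simp add: norm_divide norm_power)
  then have "norm (\<gamma> i) \<le> d"
    by (rule norm_average_limit_le) (rule average_exponential_sum_tendsto[OF assms(1-4)])
  with assms(5) show False
    by simp
qed

section \<open>Recurrence of exponential sums by compactness\<close>

text \<open>Each new index refines the subsequence found so far, and refining preserves the
  convergence already obtained.\<close>

lemma finite_family_convergent_subsequence:
  fixes X :: "'i \<Rightarrow> nat \<Rightarrow> 'a::heine_borel"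
  assumes "finite J" "\<And>j. j \<in> J \<Longrightarrow> bounded (range (X j))"
  shows "\<exists>s :: nat \<Rightarrow> nat. strict_mono s \<and> (\<forall>j\<in>J. convergent (X j \<circ> s))"
  using assms
proof (induction J rule: finite_induct)
  case empty
  show ?case
    using strict_mono_id by blast
next
  case (insert i J)
  then obtain s :: "nat \<Rightarrow> nat" where s: "strict_mono s" "\<And>j. j \<in> J \<Longrightarrow> convergent (X j \<circ> s)"
    by blast
  have "bounded (range (X i \<circ> s))"
    using insert.prems[of i] by (auto intro: bounded_subset)
  then obtain l t where t: "strict_mono t" "((X i \<circ> s) \<circ> t) \<longlonglongrightarrow> l"
    using bounded_imp_convergent_subsequence by blast
  have "convergent (X j \<circ> (s \<circ> t))" if "j \<in> insert i J" for j
    using that t s(2) convergent_subseq_convergent[of "X j \<circ> s" t]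
    by (auto simp: o_assoc convergent_def)
  moreover have "strict_mono (s \<circ> t)"
    using s(1) t(1) by (rule strict_mono_o)
  ultimately show ?case
    by blast
qed

text \<open>Along a common convergent subsequence \<open>s\<close> of exponents, consecutive powers
  are eventually close for all \<open>j\<close> at once. Cancelling \<open>z j ^ s n\<close>, which
  has norm 1, leaves the difference of the two exponents as \<open>q\<close>.\<close>

lemma unit_powers_simultaneously_close_to_1:
  fixes z :: "'i \<Rightarrow> complex"
  assumes "finite J" "\<And>j. j \<in> J \<Longrightarrow> norm (z j) = 1" "\<epsilon> > 0"
  shows "\<exists>q>0. \<forall>j\<in>J. norm (z j ^ q - 1) < \<epsilon>"
proof -
  have "bounded (range (\<lambda>n. z j ^ n))" if "j \<in> J" for j
    using assms(2)[OF that] by (auto simp: bounded_iff norm_power)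
  then obtain s :: "nat \<Rightarrow> nat"
    where s: "strict_mono s" "\<And>j. j \<in> J \<Longrightarrow> convergent ((\<lambda>n. z j ^ n) \<circ> s)"
    using finite_family_convergent_subsequence[of J "\<lambda>j n. z j ^ n"] assms(1) by auto
  have "\<forall>\<^sub>F n in sequentially. norm (z j ^ s (Suc n) - z j ^ s n) < \<epsilon>" if j: "j \<in> J" for j
  proof -
    obtain l where l: "(\<lambda>n. z j ^ s n) \<longlonglongrightarrow> l"
      using s(2)[OF j] by (auto simp: convergent_def o_def)
    have "(\<lambda>n. norm (z j ^ s (Suc n) - z j ^ s n)) \<longlonglongrightarrow> norm (l - l)"
      by (intro tendsto_intros l LIMSEQ_Suc[OF l])
    then show ?thesis
      using assms(3) by (auto intro: order_tendstoD)
  qed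
  then have "\<forall>\<^sub>F n in sequentially. \<forall>j\<in>J. norm (z j ^ s (Suc n) - z j ^ s n) < \<epsilon>"
    using assms(1) by (simp add: eventually_ball_finite)
  then obtain n where n: "\<And>j. j \<in> J \<Longrightarrow> norm (z j ^ s (Suc n) - z j ^ s n) < \<epsilon>"
    by (auto simp: eventually_sequentially)
  define q where "q = s (Suc n) - s n"
  have less: "s n < s (Suc n)"
    using s(1) by (simp add: strict_mono_def)
  have "norm (z j ^ q - 1) < \<epsilon>" if "j \<in> J" for j
  proof -
    have "z j ^ s (Suc n) - z j ^ s n = z j ^ s n * (z j ^ q - 1)"
      using less by (simp add: q_def right_diff_distrib flip: power_add)
    then show ?thesis
      using n[OF that] assms(2)[OF that] by (simp add: norm_mult norm_power)
  qed
  then show ?thesis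
    using less by (intro exI[of _ q]) (auto simp: q_def)
qed

text \<open>Raising the exponent by \<open>q\<close> multiplies each term by \<open>z j ^ q\<close>,
  which a suitable \<open>q\<close> brings close to 1 for all \<open>j\<close>
  simultaneously.\<close>

lemma exponential_sum_recurrent:
  fixes z \<gamma> :: "'i \<Rightarrow> complex"
  assumes "finite J" "\<And>j. j \<in> J \<Longrightarrow> norm (z j) = 1" "\<epsilon> > 0"
  shows "\<exists>m>n. dist (\<Sum>j\<in>J. \<gamma> j * z j ^ n) (\<Sum>j\<in>J. \<gamma> j * z j ^ m) < \<epsilon>"
proof -
  \<comment> \<open>The added 1 keeps \<open>C\<close> positive even if all coefficients vanish, and
    makes the final estimate \<open>(C - 1) * (\<epsilon> / C) < \<epsilon>\<close> strict.\<close>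
  define C where "C = (\<Sum>j\<in>J. norm (\<gamma> j)) + 1"
  have C: "C > 0"
    unfolding C_def by (simp add: add_nonneg_pos sum_nonneg)
  then obtain q where q: "q > 0" "\<And>j. j \<in> J \<Longrightarrow> norm (z j ^ q - 1) < \<epsilon> / C"
    using unit_powers_simultaneously_close_to_1[of J z "\<epsilon> / C"] assms by auto
  have "(\<Sum>j\<in>J. \<gamma> j * z j ^ (n + q)) - (\<Sum>j\<in>J. \<gamma> j * z j ^ n) =
      (\<Sum>j\<in>J. \<gamma> j * z j ^ n * (z j ^ q - 1))"
    by (simp add: power_add algebra_simps sum_subtractf)
  then have "dist (\<Sum>j\<in>J. \<gamma> j * z j ^ n) (\<Sum>j\<in>J. \<gamma> j * z j ^ (n + q)) =
      norm (\<Sum>j\<in>J. \<gamma> j * z j ^ n * (z j ^ q - 1))"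
    by (subst dist_commute) (simp only: dist_norm)
  also have "\<dots> \<le> (\<Sum>j\<in>J. norm (\<gamma> j) * (\<epsilon> / C))"
  proof (rule sum_norm_le)
    fix j assume j: "j \<in> J"
    have "norm (\<gamma> j) * norm (z j ^ q - 1) \<le> norm (\<gamma> j) * (\<epsilon> / C)"
      using q(2)[OF j] by (intro mult_left_mono) auto
    then show "norm (\<gamma> j * z j ^ n * (z j ^ q - 1)) \<le> norm (\<gamma> j) * (\<epsilon> / C)"
      using assms(2)[OF j] by (simp add: norm_mult norm_power)
  qed
  also have "\<dots> = (C - 1) * (\<epsilon> / C)"
    unfolding C_def add_diff_cancel_right' by (rule sum_distrib_right[symmetric])
  also have "\<dots> < \<epsilon>"
    using C assms(3) by (simp add: field_simps)
  finally show ?thesis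
    using q(1) by (intro exI[of _ "n + q"]) auto
qed

section \<open>Limits approximated exponentially well, and very small sums\<close>

text \<open>A jump from index \<open>n\<close> to \<open>m\<close> may cost at most half the
  decrease of \<open>p ^ n\<close> to \<open>p ^ m\<close>. These costs telescope, so all jumps
  after \<open>n\<close> together cost at most \<open>p ^ n / 2\<close>, however sparse the indices
  are.\<close>

lemma recurrent_sequence_well_approximated_limit:
  fixes f :: "nat \<Rightarrow> 'a::complete_space" and p :: real
  assumes recurrent: "\<And>n \<epsilon>. \<epsilon> > 0 \<Longrightarrow> \<exists>m>n. dist (f n) (f m) < \<epsilon>"
    and p: "0 < p" "p < 1"
  shows "\<exists>L. infinite {n. dist (f n) L < p ^ n}"
proof -
  have "\<exists>m. n < m \<and> dist (f n) (f m) \<le> (p ^ n - p ^ m) / 2" for n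
  proof -
    \<comment> \<open>The tolerance has to be fixed before \<open>m\<close> is known. The decrease
      over a single step serves, since it is at most the decrease from \<open>n\<close> to any
      larger \<open>m\<close>.\<close>
    have "p ^ Suc n < p ^ n"
      using p by (intro power_strict_decreasing) auto
    then obtain m where m: "n < m" "dist (f n) (f m) < (p ^ n - p ^ Suc n) / 2"
      using recurrent[of "(p ^ n - p ^ Suc n) / 2" n] by auto
    have "p ^ m \<le> p ^ Suc n"
      using p m(1) by (intro power_decreasing) auto
    with m show ?thesis
      by (intro exI[of _ m]) auto
  qed
  then obtain g where g: "\<And>n. n < g n \<and> dist (f n) (f (g n)) \<le> (p ^ n - p ^ g n) / 2"
    by metis
  define s where "s k = (g ^^ k) 0" for k
  have s: "s k < s (Suc k) \<and> dist (f (s k)) (f (s (Suc k))) \<le> (p ^ s k - p ^ s (Suc k)) / 2"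
    for k
    using g by (simp add: s_def)
  then have mono: "strict_mono s"
    by (simp add: strict_mono_Suc_iff)
  have telescope: "dist (f (s k)) (f (s (k + i))) \<le> (p ^ s k - p ^ s (k + i)) / 2" for k i
  proof (induction i)
    case (Suc i)
    have "dist (f (s k)) (f (s (k + Suc i)))
        \<le> dist (f (s k)) (f (s (k + i))) + dist (f (s (k + i))) (f (s (Suc (k + i))))"
      by (simp add: dist_triangle)
    with Suc s[of "k + i"] show ?case
      by simp
  qed simp
  have close: "dist (f (s k)) (f (s l)) \<le> p ^ s k / 2" if "k \<le> l" for k l
  proof -
    obtain i where "l = k + i"
      using \<open>k \<le> l\<close> le_Suc_ex by blast
    moreover have "(p ^ s k - p ^ s l) / 2 \<le> p ^ s k / 2"
      using p by simp
    ultimately show ?thesis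
      using telescope[of k i] by simp
  qed
  have lim0: "(\<lambda>k. p ^ s k) \<longlonglongrightarrow> 0"
    using LIMSEQ_subseq_LIMSEQ[OF LIMSEQ_realpow_zero[of p] mono] p by (simp add: o_def)
  have "Cauchy (f \<circ> s)"
    unfolding Cauchy_altdef
  proof (intro allI impI)
    fix e :: real
    assume "e > 0"
    then have "\<forall>\<^sub>F k in sequentially. p ^ s k < e"
      using order_tendstoD(2)[OF lim0] by blast
    then obtain M where M: "\<And>k. k \<ge> M \<Longrightarrow> p ^ s k < e"
      by (auto simp: eventually_sequentially)
    have "dist ((f \<circ> s) k) ((f \<circ> s) l) < e" if "k \<ge> M" "k < l" for k l
      using close[of k l] M[of k] that p(1) zero_less_power[of p "s k"] unfolding o_apply
      by linarith
    then show "\<exists>M. \<forall>m\<ge>M. \<forall>n>m. dist ((f \<circ> s) m) ((f \<circ> s) n) < e"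
      by blast
  qed
  then obtain L where L: "(f \<circ> s) \<longlonglongrightarrow> L"
    using Cauchy_convergent_iff convergent_def by blast
  have "dist (f (s k)) L < p ^ s k" for k
  proof -
    \<comment> \<open>Limits preserve only weak inequalities; the spare factor 2 restores strictness
      afterwards.\<close>
    have "dist (f (s k)) L \<le> p ^ s k / 2"
    proof (rule tendsto_upperbound)
      show "(\<lambda>l. dist (f (s k)) ((f \<circ> s) l)) \<longlonglongrightarrow> dist (f (s k)) L"
        by (intro tendsto_dist tendsto_const L)
      show "\<forall>\<^sub>F l in sequentially. dist (f (s k)) ((f \<circ> s) l) \<le> p ^ s k / 2"
        using eventually_ge_at_top[of k] unfolding o_apply
        by eventually_elim (rule close)
    qed simp
    with p zero_less_power[of p "s k"] show ?thesis
      by linarith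
  qed
  then have "range s \<subseteq> {n. dist (f n) L < p ^ n}"
    by auto
  moreover have "infinite (range s)"
    using mono strict_mono_imp_inj_on range_inj_infinite by blast
  ultimately show ?thesis
    using infinite_super by blast
qed

lemma infinite_Collect_pos_nat:
  assumes "infinite {n::nat. P n}"
  shows "infinite {n. n > 0 \<and> P n}"
proof
  assume "finite {n. n > 0 \<and> P n}"
  then have "finite (insert 0 {n. n > 0 \<and> P n})"
    by simp
  then have "finite {n. P n}"
    by (rule rev_finite_subset) auto
  with assms show False
    by simp
qed

text \<open>Dividing by \<open>w ^ n\<close> preserves norms and turns the unknown term into the
  constant \<open>c\<close>, so \<open>- c\<close> has to be a number approximated by the divided
  sums to within \<open>(1 / d) ^ n\<close> infinitely often.\<close>

lemma exponential_sum_infinitely_often_small: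
  fixes \<eta> \<gamma> :: "'i \<Rightarrow> complex" and w :: complex and d :: real
  assumes "finite J" "\<And>j. j \<in> J \<Longrightarrow> norm (\<eta> j) = 1" "norm w = 1" "d > 1"
  shows "\<exists>c. infinite {n. norm ((\<Sum>j\<in>J. \<gamma> j * \<eta> j ^ n) + c * w ^ n) < d powi (- int n)}"
proof -
  \<comment> \<open>The sum is taken without a minus sign here; the sign enters through the witness
    \<open>- L\<close>.\<close>
  define f where "f n = (\<Sum>j\<in>J. \<gamma> j * (\<eta> j / w) ^ n)" for n
  have "\<exists>m>n. dist (f n) (f m) < \<epsilon>" if "\<epsilon> > 0" for n \<epsilon>
    unfolding f_def using assms that
    by (intro exponential_sum_recurrent) (auto simp: norm_divide)
  then obtain L where L: "infinite {n. dist (f n) L < (1 / d) ^ n}"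
    using recurrent_sequence_well_approximated_limit[of f "1 / d"] assms(4) by auto
  have "norm ((\<Sum>j\<in>J. \<gamma> j * \<eta> j ^ n) + (- L) * w ^ n) = dist (f n) L" for n
  proof -
    have "w \<noteq> 0"
      using assms(3) by auto
    then have "(\<Sum>j\<in>J. \<gamma> j * \<eta> j ^ n) + (- L) * w ^ n = w ^ n * (f n - L)"
      by (simp add: f_def right_diff_distrib sum_distrib_left power_divide mult.commute)
    then show ?thesis
      using assms(3) by (simp add: norm_mult norm_power dist_norm)
  qed
  moreover have "d powi (- int n) = (1 / d) ^ n" for n
    by (simp add: power_int_minus power_one_over inverse_eq_divide)
  ultimately show ?thesis
    using L by (intro exI[of _ "- L"]) simp
qed

theorem theorem2:
  fixes r :: nat
  assumes "r \<ge> 2"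
  shows
    "(\<forall>\<eta> \<gamma> :: nat \<Rightarrow> complex.
        inj_on \<eta> {1..r} \<and> (\<forall>j\<in>{1..r}. norm (\<eta> j) = 1) \<and> (\<forall>j\<in>{1..r}. \<gamma> j \<noteq> 0) \<longrightarrow>
        (\<exists>d\<^sub>1::real. d\<^sub>1 > 0 \<and>
          infinite {n::nat. n > 0 \<and> norm (\<Sum>j=1..r. \<gamma> j * \<eta> j ^ n) > d\<^sub>1})) \<and>
     (\<forall>\<eta> \<gamma> :: nat \<Rightarrow> complex.
        inj_on \<eta> {1..r} \<and> (\<forall>j\<in>{1..r}. norm (\<eta> j) = 1) \<and>
        (\<exists>j\<in>{1..<r}. \<not> root_of_unity (\<eta> j / \<eta> r)) \<and> (\<forall>j\<in>{1..<r}. \<gamma> j \<noteq> 0) \<longrightarrow>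
        (\<forall>d\<^sub>2::real. d\<^sub>2 > 1 \<longrightarrow>
          (\<exists>\<gamma>\<^sub>r::complex.
            infinite {n::nat. n > 0 \<and>
              norm ((\<Sum>j=1..<r. \<gamma> j * \<eta> j ^ n) + \<gamma>\<^sub>r * \<eta> r ^ n) < d\<^sub>2 powi (- int n)})))"
proof (intro conjI allI impI)
  fix \<eta> \<gamma> :: "nat \<Rightarrow> complex"
  assume *: "inj_on \<eta> {1..r} \<and> (\<forall>j\<in>{1..r}. norm (\<eta> j) = 1) \<and> (\<forall>j\<in>{1..r}. \<gamma> j \<noteq> 0)"
  have r: "r \<in> {1..r}"
    using assms by simp
  \<comment> \<open>Any positive number below \<open>norm (\<gamma> r)\<close> would serve as the
    constant; half of it is taken.\<close>
  with * have "norm (\<gamma> r) / 2 > 0" "norm (\<gamma> r) / 2 < norm (\<gamma> r)"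
    by auto
  then show "\<exists>d\<^sub>1::real. d\<^sub>1 > 0 \<and>
      infinite {n::nat. n > 0 \<and> norm (\<Sum>j=1..r. \<gamma> j * \<eta> j ^ n) > d\<^sub>1}"
    using * r
    by (intro exI[of _ "norm (\<gamma> r) / 2"] conjI infinite_Collect_pos_nat
        exponential_sum_infinitely_often_large[where i = r]) auto
next
  fix \<eta> \<gamma> :: "nat \<Rightarrow> complex" and d\<^sub>2 :: real
  assume *: "inj_on \<eta> {1..r} \<and> (\<forall>j\<in>{1..r}. norm (\<eta> j) = 1) \<and>
      (\<exists>j\<in>{1..<r}. \<not> root_of_unity (\<eta> j / \<eta> r)) \<and> (\<forall>j\<in>{1..<r}. \<gamma> j \<noteq> 0)"
    and d: "d\<^sub>2 > 1"
  \<comment> \<open>The prescribed terms are those with index below \<open>r\<close>, and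
    \<open>\<eta> r\<close> plays the part of \<open>w\<close>.\<close>
  obtain c where "infinite {n. norm ((\<Sum>j=1..<r. \<gamma> j * \<eta> j ^ n) + c * \<eta> r ^ n)
      < d\<^sub>2 powi (- int n)}"
    using exponential_sum_infinitely_often_small[of "{1..<r}" \<eta> "\<eta> r" d\<^sub>2 \<gamma>] * d assms
    by auto
  then show "\<exists>\<gamma>\<^sub>r::complex. infinite {n::nat. n > 0 \<and>
      norm ((\<Sum>j=1..<r. \<gamma> j * \<eta> j ^ n) + \<gamma>\<^sub>r * \<eta> r ^ n) < d\<^sub>2 powi (- int n)}"
    by (intro exI[of _ c] infinite_Collect_pos_nat)
qed

end
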